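(* Let $G=(V,E)$ be a finite undirected simple graph with $|V|$ even. For $v\in V$ let $\deg v$ denote the degree of $v$ in $G$, and let $\operatorname{perfmat} G$ denote the number of perfect matchings in $G$. Then $$\operatorname{perfmat} G\le \prod_{v\in V} \big((\deg v)!\big)^{\frac{1}{2\deg v}},$$ where the factor corresponding to a vertex $v$ with $\deg v=0$ is interpreted as $0$. Moreover, if $G$ has no isolated vertices, then equality holds if and only if $G$ is a disjoint union of complete balanced bipartite graphs.
   Context: A perfect matching of $G$ is a set of edges of $G$ such that every vertex of $G$ is incident to exactly one edge of the set. A complete balanced bipartite graph is a graph isomorphic to $K_{d,d}$ for some integer $d\ge 1$ (the sizes $d$ may differ between the components of the disjoint union). An isolated vertex is a vertex of degree $0$. *)

theory Defs
  imports Complex_Main "HOL-Library.Ramsey"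
begin

locale finite_simple_graph =
  fixes V :: "'a set" and E :: "'a set set"
  assumes finite_verts: "finite V"
    and edges: "E \<subseteq> [V]\<^bsup>2\<^esup>"

definition vdegree :: "'a set set \<Rightarrow> 'a \<Rightarrow> nat" where
  "vdegree E v = card {e \<in> E. v \<in> e}"

definition isolated :: "'a set set \<Rightarrow> 'a \<Rightarrow> bool" where
  "isolated E v \<longleftrightarrow> vdegree E v = 0"

definition perfect_matching :: "'a set \<Rightarrow> 'a set set \<Rightarrow> 'a set set \<Rightarrow> bool" where
  "perfect_matching V E M \<longleftrightarrow> M \<subseteq> E \<and> (\<forall>v\<in>V. \<exists>!e. e \<in> M \<and> v \<in> e)"

definition perfmat :: "'a set \<Rightarrow> 'a set set \<Rightarrow> nat" where
  "perfmat V E = card {M. perfect_matching V E M}"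

(* The case distinction is needed: with division by zero yielding 0,
   the formula alone would give 1 for an isolated vertex. *)
definition degree_factor :: "'a set set \<Rightarrow> 'a \<Rightarrow> real" where
  "degree_factor E v =
     (if vdegree E v = 0 then 0 else fact (vdegree E v) powr (1 / (2 * real (vdegree E v))))"

definition graph_iso :: "'a set \<Rightarrow> 'a set set \<Rightarrow> 'b set \<Rightarrow> 'b set set \<Rightarrow> bool" where
  "graph_iso V E V' E' \<longleftrightarrow>
     (\<exists>f. bij_betw f V V' \<and> (\<forall>u\<in>V. \<forall>v\<in>V. {u, v} \<in> E \<longleftrightarrow> {f u, f v} \<in> E'))"

definition complete_bipartite_verts :: "nat \<Rightarrow> nat \<Rightarrow> (nat + nat) set" where
  "complete_bipartite_verts m n = {..<m} <+> {..<n}"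

definition complete_bipartite_edges :: "nat \<Rightarrow> nat \<Rightarrow> (nat + nat) set set" where
  "complete_bipartite_edges m n = {{Inl i, Inr j} | i j. i < m \<and> j < n}"

definition complete_balanced_bipartite :: "'a set \<Rightarrow> 'a set set \<Rightarrow> bool" where
  "complete_balanced_bipartite V E \<longleftrightarrow> finite_simple_graph V E \<and>
     (\<exists>d\<ge>1. graph_iso V E (complete_bipartite_verts d d) (complete_bipartite_edges d d))"

(* C is the set of component graphs; it may be empty, so that the graph without
   vertices counts as a disjoint union. *)
definition disjoint_union_of_complete_balanced_bipartite ::
    "'a set \<Rightarrow> 'a set set \<Rightarrow> bool" where
  "disjoint_union_of_complete_balanced_bipartite V E \<longleftrightarrow>
     (\<exists>C :: ('a set \<times> 'a set set) set.
        (\<forall>H\<in>C. complete_balanced_bipartite (fst H) (snd H)) \<and>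
        pairwise (\<lambda>H K. disjnt (fst H) (fst K)) C \<and>
        V = (\<Union>H\<in>C. fst H) \<and> E = (\<Union>H\<in>C. snd H))"

end

theory Submission
  imports Defs
begin

text \<open>
  Schrijver's inductive proof of the Bregman-Minc inequality for permanents carries over
  to matchings of general graphs. Write \<open>P\<close> for the number of perfect matchings of the graph,
  \<open>P\<^sub>e\<close> for the number of those that contain the edge \<open>e\<close>, which is also the number of perfect
  matchings of the graph left after deleting the two ends of \<open>e\<close>, and \<open>\<phi> d = ln (d!) / (2 d)\<close>. The
  claim is \<open>ln P \<le> \<Sum>\<^sub>v \<phi> (deg v)\<close> whenever \<open>P > 0\<close>.

  For a fixed vertex \<open>v\<close> the numbers \<open>P\<^sub>e\<close> over the \<open>deg v\<close> edges \<open>e\<close> at \<open>v\<close> sum to \<open>P\<close>, so convexity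
  of \<open>t ln t\<close> gives \<open>P ln P \<le> P ln (deg v) + \<Sum> P\<^sub>e ln P\<^sub>e\<close>. Summed over all \<open>v\<close> this bounds
  \<open>|V| P ln P\<close> by a sum over the perfect matchings \<open>M\<close> of \<open>\<Sum>\<^sub>v ln (deg v) + 2 \<Sum>\<^sub>e\<^sub>\<in>\<^sub>M ln P\<^sub>e\<close>. The
  induction hypothesis bounds every \<open>ln P\<^sub>e\<close> by the degrees that remain after deleting \<open>e\<close>. It then
  suffices to compare, for each single matching \<open>M\<close> and each vertex \<open>w\<close>, the contributions of \<open>w\<close>.
  When \<open>e\<close> runs through the edges of \<open>M\<close> that avoid \<open>w\<close>, the degree of \<open>w\<close> drops by 0, 1 or 2, and by
  \<open>deg w - 1\<close> in total. If no drop is 2, the contributions of \<open>w\<close> add up to exactly \<open>|V| \<phi> (deg w)\<close>;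
  drops of 2, which are the new feature compared with bipartite graphs, only help because \<open>\<phi>\<close> is
  strictly concave.

  The difference of the two sides of the final inequality is an exact sum of three kinds of
  nonnegative slack (\<open>slack_sum\<close>), so equality forces each of them to vanish. This says that adjacent
  vertices have equal degrees, that there are no triangles, and that the graph stays extremal after
  deleting the ends of any edge. Comparing degrees before and after such a deletion shows
  that the neighbourhoods of the two ends of an edge are completely joined to each other
  (\<open>tight_imp_balanced_biclique_at_edges\<close>), so that the components are balanced bicliques. Conversely,
  for graphs of this kind the number of perfect matchings is found by expanding along the edges at
  one vertex (\<open>perfmat_balanced_biclique\<close>).
\<close>

section \<open>The logarithm of a degree factor\<close>

definition log_factor :: "nat \<Rightarrow> real" where
  "log_factor d = ln (fact d) / (2 * real d)"

lemma two_mult_log_factor: "2 * real d * log_factor d = ln (fact d)"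
  by (cases "d = 0") (auto simp: log_factor_def)

lemma ln_fact_Suc: "ln (fact (Suc k) :: real) = ln (real (Suc k)) + ln (fact k)"
  by (simp only: fact_Suc, subst ln_mult_pos) (simp_all del: of_nat_Suc)

text \<open>This is the strict concavity of \<open>ln (d!) / d\<close> at \<open>d\<close> with the denominators cleared. From \<open>d\<close> to
  \<open>d + 1\<close> the difference of the two sides grows by \<open>d (d + 1) (2 ln (d + 1) - ln (d (d + 2)))\<close>, which is
  positive because \<open>d (d + 2) < (d + 1)\<^sup>2\<close>.\<close>
lemma ln_fact_less:
  assumes "d \<ge> 2"
  shows "2 * ln (fact d) < real d * (real d + 1) * ln (real d) - real d * (real d - 1) * ln (real d + 1)"
  using assms
proof (induction d rule: nat_induct_at_least)
  case base
  have "ln (3 ^ 2 :: real) < ln (2 ^ 4)" by (subst ln_less_cancel_iff) auto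
  then have "2 * ln (3::real) < 4 * ln 2" by (simp only: ln_realpow zero_less_numeral of_nat_numeral)
  then show ?case by (simp add: fact_2)
next
  case (Suc d)
  let ?d = "real d"
  have d: "?d > 0" using Suc.hyps by simp
  have "ln (?d * (?d + 2)) < ln ((?d + 1) ^ 2)"
    using d by (subst ln_less_cancel_iff) (auto simp: power2_eq_square algebra_simps add_pos_pos)
  moreover have "ln (?d * (?d + 2)) = ln ?d + ln (?d + 2)" using d by (simp add: ln_mult_pos)
  moreover have "ln ((?d + 1) ^ 2) = 2 * ln (?d + 1)" using d by (simp add: ln_realpow)
  ultimately have "0 < 2 * ln (?d + 1) - ln ?d - ln (?d + 2)" by simp
  then have "0 < ?d * (?d + 1) * (2 * ln (?d + 1) - ln ?d - ln (?d + 2))" using d by simp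
  moreover have "ln (fact (Suc d) :: real) = ln (?d + 1) + ln (fact d)"
    using d by (simp add: ln_mult_pos add.commute)
  moreover have "real (Suc d) = ?d + 1" "?d + 1 + 1 = ?d + 2" by simp_all
  ultimately show ?case using Suc.IH by (simp only:) (simp add: algebra_simps)
qed

lemma log_factor_strictly_concave:
  assumes "d \<ge> 2"
  shows "log_factor (d + 1) + log_factor (d - 1) < 2 * log_factor d"
proof -
  let ?x = "real d" and ?L = "ln (fact d :: real)"
  have x: "?x > 1" using assms by simp
  obtain k where k: "d = Suc k" using assms by (cases d) auto
  have up: "ln (fact (d + 1) :: real) = ln (?x + 1) + ?L"
    using x by (simp add: ln_mult_pos add.commute)
  have down: "ln (fact (d - 1) :: real) = ?L - ln ?x"
    using x by (simp add: k ln_mult_pos)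
  have real_pred: "real (d - 1) = ?x - 1" using k by simp
  have "2 * ?x * (?x + 1) * (?x - 1) * (2 * log_factor d - log_factor (d + 1) - log_factor (d - 1))
      = 2 * (?x + 1) * (?x - 1) * ?L - ?x * (?x - 1) * (ln (?x + 1) + ?L) - ?x * (?x + 1) * (?L - ln ?x)"
    using x unfolding log_factor_def up down real_pred by (simp add: divide_simps) (simp add: algebra_simps)
  also have "\<dots> = ?x * (?x + 1) * ln ?x - ?x * (?x - 1) * ln (?x + 1) - 2 * ?L"
    by (simp add: algebra_simps)
  also have "\<dots> > 0" using ln_fact_less[OF assms] by simp
  finally have "0 < 2 * ?x * (?x + 1) * (?x - 1) * (2 * log_factor d - log_factor (d + 1) - log_factor (d - 1))" .
  moreover have "0 < 2 * ?x * (?x + 1) * (?x - 1)" using x by simp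
  ultimately have "0 < 2 * log_factor d - log_factor (d + 1) - log_factor (d - 1)" by (rule zero_less_mult_pos)
  then show ?thesis by simp
qed

text \<open>Concavity puts \<open>log_factor\<close> below its secant through \<open>d - 1\<close> and \<open>d\<close>. At a drop of 2 the point lies
  strictly below, which excludes triangles from extremal graphs.\<close>
lemma log_factor_diff_le:
  assumes "c \<le> 2" "c < d"
  shows "log_factor (d - c) \<le> log_factor d - real c * (log_factor d - log_factor (d - 1))"
    and "log_factor (d - c) = log_factor d - real c * (log_factor d - log_factor (d - 1)) \<Longrightarrow> c \<le> 1"
proof -
  consider "c = 0" | "c = 1" | "c = 2" using assms(1) by linarith
  then have "log_factor (d - c) \<le> log_factor d - real c * (log_factor d - log_factor (d - 1)) \<and>
    (log_factor (d - c) = log_factor d - real c * (log_factor d - log_factor (d - 1)) \<longrightarrow> c \<le> 1)"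
  proof cases
    case 3
    then have "d - 1 \<ge> 2" "d - 1 + 1 = d" "d - 1 - 1 = d - 2" using assms by auto
    then show ?thesis using log_factor_strictly_concave[of "d - 1"] 3 by simp
  qed auto
  then show "log_factor (d - c) \<le> log_factor d - real c * (log_factor d - log_factor (d - 1))"
    and "log_factor (d - c) = log_factor d - real c * (log_factor d - log_factor (d - 1)) \<Longrightarrow> c \<le> 1" by auto
qed

section \<open>Gibbs' inequality\<close>

text \<open>With \<open>q\<close> the mean of the \<open>p a\<close>, summing \<open>p a * ln (q / p a) \<le> q - p a\<close> over \<open>a\<close> gives the
  inequality, and equality forces every term to be tight. The values \<open>p a = 0\<close> are covered
  since \<open>ln 0 = 0\<close>, in agreement with the usual convention \<open>0 ln 0 = 0\<close>.\<close>

lemma gibbs_inequality: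
  fixes p :: "'b \<Rightarrow> real"
  assumes "finite A" and nonneg: "\<And>a. a \<in> A \<Longrightarrow> p a \<ge> 0" and pos: "sum p A > 0"
  shows "sum p A * ln (sum p A) \<le> sum p A * ln (card A) + (\<Sum>a\<in>A. p a * ln (p a))"
    and "sum p A * ln (sum p A) = sum p A * ln (card A) + (\<Sum>a\<in>A. p a * ln (p a)) \<Longrightarrow>
      a \<in> A \<Longrightarrow> p a * card A = sum p A"
proof -
  define S where "S = sum p A"
  define q where "q = S / card A"
  define g where "g a = q - p a - p a * (ln q - ln (p a))" for a
  have "A \<noteq> {}" using pos by auto
  then have card: "real (card A) > 0" using assms(1) by (simp add: card_gt_0_iff)
  have S: "S > 0" using pos S_def by simp
  have q: "q > 0" using card S by (simp add: q_def)
  have g: "g a \<ge> 0 \<and> (g a = 0 \<longrightarrow> p a = q)" if "a \<in> A" for a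
  proof (cases "p a = 0")
    case True
    then show ?thesis using q by (simp add: g_def)
  next
    case False
    then have pa: "p a > 0" using nonneg[OF that] by simp
    have eq: "g a = p a * (q / p a - 1 - ln (q / p a))"
      using pa q by (simp add: g_def ln_div field_simps)
    have "ln (q / p a) \<le> q / p a - 1" using pa q by (intro ln_le_minus_one) simp
    moreover have "q / p a = 1" if "ln (q / p a) = q / p a - 1"
      using ln_eq_minus_one[OF _ that] pa q by simp
    ultimately show ?thesis using pa unfolding eq by simp
  qed
  have "sum g A = real (card A) * q - S - (S * ln q - (\<Sum>a\<in>A. p a * ln (p a)))"
    by (simp add: g_def S_def sum_subtractf sum_distrib_right right_diff_distrib)
  also have "\<dots> = S * ln (card A) + (\<Sum>a\<in>A. p a * ln (p a)) - S * ln S"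
    using card S by (simp add: q_def ln_div algebra_simps)
  finally have sum_g: "sum g A = S * ln (card A) + (\<Sum>a\<in>A. p a * ln (p a)) - S * ln S" .
  have "sum g A \<ge> 0" using g by (intro sum_nonneg) auto
  then show "sum p A * ln (sum p A) \<le> sum p A * ln (card A) + (\<Sum>a\<in>A. p a * ln (p a))"
    using sum_g unfolding S_def by linarith
  assume "sum p A * ln (sum p A) = sum p A * ln (card A) + (\<Sum>a\<in>A. p a * ln (p a))" and "a \<in> A"
  then have "sum g A = 0" using sum_g unfolding S_def by linarith
  then have "g a = 0" using g \<open>a \<in> A\<close> assms(1) by (simp add: sum_nonneg_eq_0_iff)
  then show "p a * card A = sum p A" using g[OF \<open>a \<in> A\<close>] card by (simp add: q_def S_def)
qed

section \<open>Deleting the ends of an edge\<close>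

definition neighbours :: "'a set set \<Rightarrow> 'a \<Rightarrow> 'a set" where
  "neighbours E v = {w. {v, w} \<in> E}"

definition avoiding :: "'a set set \<Rightarrow> 'a set \<Rightarrow> 'a set set" where
  "avoiding E e = {f \<in> E. disjnt f e}"

lemma neighbours_commute: "w \<in> neighbours E v \<longleftrightarrow> v \<in> neighbours E w"
  by (simp add: neighbours_def insert_commute)

context finite_simple_graph
begin

lemma edge_subset: "e \<in> E \<Longrightarrow> e \<subseteq> V"
  and finite_edge: "e \<in> E \<Longrightarrow> finite e"
  and card_edge: "e \<in> E \<Longrightarrow> card e = 2"
  using edges by (auto simp: nsets_def)

lemma finite_edges: "finite E"
  using edges finite_verts finite_imp_finite_nsets finite_subset by blast

lemma edge_other_end:
  assumes "e \<in> E" "v \<in> e"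
  obtains w where "e = {v, w}" "w \<noteq> v" "w \<in> V"
  using assms card_edge[OF assms(1)] edge_subset[OF assms(1)]
  by (auto simp: card_2_iff doubleton_eq_iff)

lemma edge_ends: "{u, v} \<in> E \<Longrightarrow> u \<noteq> v \<and> u \<in> V \<and> v \<in> V"
  using card_edge[of "{u, v}"] edge_subset[of "{u, v}"] by (cases "u = v") auto

lemma neighbours_subset: "neighbours E v \<subseteq> V"
  using edge_ends by (auto simp: neighbours_def)

lemma finite_neighbours: "finite (neighbours E v)"
  using neighbours_subset finite_verts finite_subset by blast

lemma not_neighbour_self: "v \<notin> neighbours E v"
  using edge_ends[of v v] by (auto simp: neighbours_def)

lemma vdegree_eq_card_neighbours: "vdegree E v = card (neighbours E v)"
proof -
  have "bij_betw (\<lambda>w. {v, w}) (neighbours E v) {e \<in> E. v \<in> e}"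
  proof (rule bij_betwI')
    fix e assume "e \<in> {e \<in> E. v \<in> e}"
    then show "\<exists>w\<in>neighbours E v. e = {v, w}"
      by (auto elim: edge_other_end simp: neighbours_def)
  qed (auto simp: neighbours_def doubleton_eq_iff)
  then show ?thesis unfolding vdegree_def by (simp add: bij_betw_same_card)
qed

lemma avoiding_graph: "finite_simple_graph (V - e) (avoiding E e)"
proof
  show "finite (V - e)" using finite_verts by simp
  show "avoiding E e \<subseteq> [V - e]\<^bsup>2\<^esup>"
    using edges by (auto simp: avoiding_def nsets_def disjnt_iff)
qed

lemma neighbours_avoiding: "w \<notin> e \<Longrightarrow> neighbours (avoiding E e) w = neighbours E w - e"
  by (auto simp: neighbours_def avoiding_def)

lemma vdegree_avoiding:
  assumes "w \<notin> e"
  shows "vdegree (avoiding E e) w = vdegree E w - card (neighbours E w \<inter> e)"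
proof -
  interpret del: finite_simple_graph "V - e" "avoiding E e" by (rule avoiding_graph)
  show ?thesis
    using assms finite_neighbours
    by (simp add: del.vdegree_eq_card_neighbours vdegree_eq_card_neighbours
        neighbours_avoiding card_Diff_subset_Int)
qed

section \<open>Counting perfect matchings\<close>

lemma finite_matchings: "finite {M. perfect_matching V E M}"
  by (rule finite_subset[of _ "Pow E"]) (auto simp: perfect_matching_def finite_edges)

lemma matching_disjoint:
  assumes "perfect_matching V E M" "e \<in> M" "f \<in> M" "v \<in> e" "v \<in> f"
  shows "e = f"
  using assms edge_subset unfolding perfect_matching_def by (metis in_mono)

lemma matching_Union: "perfect_matching V E M \<Longrightarrow> \<Union>M = V"
  using edge_subset unfolding perfect_matching_def by blast

lemma matching_finite: "perfect_matching V E M \<Longrightarrow> finite M"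
  using finite_edges finite_subset unfolding perfect_matching_def by blast

text \<open>The edges of a perfect matching partition the vertices.\<close>
lemma sum_card_Int_matching:
  assumes "perfect_matching V E M" "A \<subseteq> V"
  shows "(\<Sum>e\<in>M. card (A \<inter> e)) = card A"
proof -
  have "card (\<Union>e\<in>M. A \<inter> e) = (\<Sum>e\<in>M. card (A \<inter> e))"
  proof (rule card_UN_disjoint)
    show "finite M" using assms matching_finite by blast
    show "\<forall>e\<in>M. finite (A \<inter> e)" using assms(2) finite_verts finite_subset by blast
    show "\<forall>e\<in>M. \<forall>f\<in>M. e \<noteq> f \<longrightarrow> A \<inter> e \<inter> (A \<inter> f) = {}"
      using matching_disjoint[OF assms(1)] by blast
  qed
  moreover have "(\<Union>e\<in>M. A \<inter> e) = A" using matching_Union[OF assms(1)] assms(2) by blast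
  ultimately show ?thesis by simp
qed

lemma card_verts_matching:
  assumes "perfect_matching V E M"
  shows "card V = 2 * card M"
proof -
  have "card V = (\<Sum>e\<in>M. card (V \<inter> e))" using sum_card_Int_matching[OF assms] by simp
  also have "\<dots> = (\<Sum>e\<in>M. 2)"
    using assms edge_subset card_edge
    by (intro sum.cong) (auto simp: perfect_matching_def Int_absorb1)
  finally show ?thesis by simp
qed

text \<open>Adding \<open>e\<close> to a perfect matching that avoids its ends is a bijection, with inverse removing \<open>e\<close>.\<close>
lemma perfmat_avoiding:
  assumes "e \<in> E"
  shows "perfmat (V - e) (avoiding E e) = card {M. perfect_matching V E M \<and> e \<in> M}"
proof -
  have ne: "e \<noteq> {}" using card_edge[OF assms] by auto
  have "bij_betw (insert e) {M. perfect_matching (V - e) (avoiding E e) M}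
      {M. perfect_matching V E M \<and> e \<in> M}"
  proof (rule bij_betw_byWitness[where f' = "\<lambda>M. M - {e}"])
    show "\<forall>M\<in>{M. perfect_matching (V - e) (avoiding E e) M}. insert e M - {e} = M"
      using ne by (auto simp: perfect_matching_def avoiding_def disjnt_iff)
    show "\<forall>M\<in>{M. perfect_matching V E M \<and> e \<in> M}. insert e (M - {e}) = M" by auto
    show "insert e ` {M. perfect_matching (V - e) (avoiding E e) M} \<subseteq> {M. perfect_matching V E M \<and> e \<in> M}"
    proof clarsimp
      fix M assume M: "perfect_matching (V - e) (avoiding E e) M"
      have "\<exists>!f. (f = e \<or> f \<in> M) \<and> v \<in> f" if "v \<in> V" for v
      proof (cases "v \<in> e")
        case True
        then show ?thesis using M by (intro ex1I[of _ e]) (auto simp: perfect_matching_def avoiding_def disjnt_iff)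
      next
        case False
        then have "\<exists>!f. f \<in> M \<and> v \<in> f" using M that by (auto simp: perfect_matching_def)
        then show ?thesis using False by blast
      qed
      then show "perfect_matching V E (insert e M)"
        using M assms by (auto simp: perfect_matching_def avoiding_def)
    qed
    show "(\<lambda>M. M - {e}) ` {M. perfect_matching V E M \<and> e \<in> M} \<subseteq> {M. perfect_matching (V - e) (avoiding E e) M}"
    proof clarsimp
      fix M assume M: "perfect_matching V E M" and e: "e \<in> M"
      have "disjnt f e" if "f \<in> M" "f \<noteq> e" for f
        using matching_disjoint[OF M that(1) e] that(2) by (auto simp: disjnt_iff)
      moreover have "\<exists>!f. (f \<in> M \<and> f \<noteq> e) \<and> v \<in> f" if "v \<in> V - e" for v
      proof -
        have "\<exists>!f. f \<in> M \<and> v \<in> f" using M that by (auto simp: perfect_matching_def)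
        then show ?thesis using that by blast
      qed
      ultimately show "perfect_matching (V - e) (avoiding E e) (M - {e})"
        using M by (auto simp: perfect_matching_def avoiding_def)
    qed
  qed
  then show ?thesis unfolding perfmat_def by (simp add: bij_betw_same_card)
qed

text \<open>The analogue of expanding a permanent along a row: every perfect matching contains exactly one
  edge at \<open>v\<close>.\<close>
lemma perfmat_expand:
  assumes "v \<in> V"
  shows "perfmat V E = (\<Sum>e | e \<in> E \<and> v \<in> e. perfmat (V - e) (avoiding E e))"
proof -
  have "{M. perfect_matching V E M} =
      (\<Union>e\<in>{e. e \<in> E \<and> v \<in> e}. {M. perfect_matching V E M \<and> e \<in> M})"
    using assms unfolding perfect_matching_def by blast
  then have "perfmat V E = card (\<Union>e\<in>{e. e \<in> E \<and> v \<in> e}. {M. perfect_matching V E M \<and> e \<in> M})"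
    by (simp add: perfmat_def)
  also have "\<dots> = (\<Sum>e | e \<in> E \<and> v \<in> e. card {M. perfect_matching V E M \<and> e \<in> M})"
  proof (rule card_UN_disjoint)
    show "finite {e. e \<in> E \<and> v \<in> e}" using finite_edges by simp
    show "\<forall>e\<in>{e. e \<in> E \<and> v \<in> e}. finite {M. perfect_matching V E M \<and> e \<in> M}"
      using finite_matchings by simp
    show "\<forall>e\<in>{e. e \<in> E \<and> v \<in> e}. \<forall>f\<in>{e. e \<in> E \<and> v \<in> e}. e \<noteq> f \<longrightarrow>
        {M. perfect_matching V E M \<and> e \<in> M} \<inter> {M. perfect_matching V E M \<and> f \<in> M} = {}"
      using matching_disjoint by blast
  qed
  also have "\<dots> = (\<Sum>e | e \<in> E \<and> v \<in> e. perfmat (V - e) (avoiding E e))"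
    by (intro sum.cong) (auto simp: perfmat_avoiding)
  finally show ?thesis .
qed

lemma perfmat_isolated:
  assumes "v \<in> V" "vdegree E v = 0"
  shows "perfmat V E = 0"
proof -
  have none: "{e \<in> E. v \<in> e} = {}" using assms(2) finite_edges by (simp add: vdegree_def)
  show ?thesis unfolding perfmat_expand[OF assms(1)] none by simp
qed

lemma sum_matchings_eq_sum_edges:
  fixes g :: "'a set \<Rightarrow> real"
  shows "(\<Sum>M | perfect_matching V E M. \<Sum>e\<in>M. g e)
    = (\<Sum>e\<in>E. real (perfmat (V - e) (avoiding E e)) * g e)"
proof -
  have "(\<Sum>M | perfect_matching V E M. \<Sum>e\<in>M. g e)
      = (\<Sum>M | perfect_matching V E M. \<Sum>e | e \<in> E \<and> e \<in> M. g e)"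
    by (intro sum.cong refl) (auto simp: perfect_matching_def)
  also have "\<dots> = (\<Sum>e\<in>E. \<Sum>M | M \<in> {M. perfect_matching V E M} \<and> e \<in> M. g e)"
    using sum.swap_restrict[OF finite_matchings finite_edges, of "\<lambda>M e. g e" "\<lambda>M e. e \<in> M"] by simp
  also have "\<dots> = (\<Sum>e\<in>E. real (perfmat (V - e) (avoiding E e)) * g e)"
    by (intro sum.cong) (auto simp: perfmat_avoiding)
  finally show ?thesis .
qed

lemma sum_verts_sum_incident_edges:
  fixes g :: "'a set \<Rightarrow> real"
  shows "(\<Sum>v\<in>V. \<Sum>e | e \<in> E \<and> v \<in> e. g e) = 2 * (\<Sum>e\<in>E. g e)"
proof -
  have "(\<Sum>v\<in>V. \<Sum>e | e \<in> E \<and> v \<in> e. g e) = (\<Sum>e\<in>E. \<Sum>v | v \<in> V \<and> v \<in> e. g e)"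
    by (rule sum.swap_restrict[OF finite_verts finite_edges])
  also have "\<dots> = (\<Sum>e\<in>E. 2 * g e)"
  proof (intro sum.cong refl)
    fix e assume e: "e \<in> E"
    then have "{v. v \<in> V \<and> v \<in> e} = e" using edge_subset by blast
    then show "(\<Sum>v | v \<in> V \<and> v \<in> e. g e) = 2 * g e" using card_edge[OF e] by simp
  qed
  finally show ?thesis by (simp add: sum_distrib_left)
qed

lemma perfmat_no_verts:
  assumes "V = {}"
  shows "E = {}" and "perfmat V E = 1"
proof -
  show "E = {}"
  proof (rule ccontr)
    assume "E \<noteq> {}"
    then obtain e where "e \<in> E" by blast
    then show False using edge_subset card_edge assms by fastforce
  qed
  then have "{M. perfect_matching V E M} = {{}}" using assms by (auto simp: perfect_matching_def)
  then show "perfmat V E = 1" by (simp add: perfmat_def)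
qed

section \<open>The upper bound\<close>

text \<open>Gibbs' inequality for the distribution of the edge at \<open>v\<close> in a random perfect matching. In the
  equality case all edges at \<open>v\<close> lie in equally many perfect matchings, so for adjacent vertices,
  which share an edge, the degrees agree.\<close>

lemma vertex_slack:
  assumes "v \<in> V" "perfmat V E > 0"
  shows "real (perfmat V E) * ln (perfmat V E) \<le> real (perfmat V E) * ln (vdegree E v)
      + (\<Sum>e | e \<in> E \<and> v \<in> e. real (perfmat (V - e) (avoiding E e)) * ln (perfmat (V - e) (avoiding E e)))"
    and "real (perfmat V E) * ln (perfmat V E) = real (perfmat V E) * ln (vdegree E v)
      + (\<Sum>e | e \<in> E \<and> v \<in> e. real (perfmat (V - e) (avoiding E e)) * ln (perfmat (V - e) (avoiding E e))) \<Longrightarrow>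
      e \<in> E \<Longrightarrow> v \<in> e \<Longrightarrow> perfmat (V - e) (avoiding E e) * vdegree E v = perfmat V E"
proof -
  let ?p = "\<lambda>e. real (perfmat (V - e) (avoiding E e))" and ?A = "{e. e \<in> E \<and> v \<in> e}"
  have fin: "finite ?A" using finite_edges by simp
  have sum: "sum ?p ?A = real (perfmat V E)" using perfmat_expand[OF assms(1)] by simp
  have pos: "sum ?p ?A > 0" using assms(2) by (simp add: sum)
  have card: "card ?A = vdegree E v" by (simp add: vdegree_def)
  note gibbs_inequality = gibbs_inequality[OF fin _ pos, unfolded sum card]
  show "real (perfmat V E) * ln (perfmat V E) \<le> real (perfmat V E) * ln (vdegree E v) + (\<Sum>e\<in>?A. ?p e * ln (?p e))"
    by (rule gibbs_inequality(1)) simp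
  assume "real (perfmat V E) * ln (perfmat V E) = real (perfmat V E) * ln (vdegree E v) + (\<Sum>e\<in>?A. ?p e * ln (?p e))"
    and "e \<in> E" "v \<in> e"
  then have "?p e * real (vdegree E v) = real (perfmat V E)" by (intro gibbs_inequality(2)) auto
  then show "perfmat (V - e) (avoiding E e) * vdegree E v = perfmat V E"
    by (simp flip: of_nat_mult)
qed

text \<open>If \<open>e\<close> runs through the edges of \<open>M\<close> that miss \<open>w\<close>, the degree of \<open>w\<close> drops by the number of
  neighbours of \<open>w\<close> in \<open>e\<close>. These drops add up to \<open>d - 1\<close> with \<open>d = deg w\<close>, since only the partner of
  \<open>w\<close> is missed. Replacing \<open>log_factor\<close> by its secant through \<open>d - 1\<close> and \<open>d\<close> makes the sum depend on
  the total drop alone, and then both sides agree because \<open>d! = d * (d - 1)!\<close>.\<close>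
lemma matching_slack:
  assumes M: "perfect_matching V E M" and w: "w \<in> V"
  shows "ln (vdegree E w) + 2 * (\<Sum>e | e \<in> M \<and> w \<notin> e. log_factor (vdegree (avoiding E e) w))
      \<le> real (card V) * log_factor (vdegree E w)"
    and "ln (vdegree E w) + 2 * (\<Sum>e | e \<in> M \<and> w \<notin> e. log_factor (vdegree (avoiding E e) w))
      = real (card V) * log_factor (vdegree E w) \<Longrightarrow> e \<in> M \<Longrightarrow> w \<notin> e \<Longrightarrow> card (neighbours E w \<inter> e) \<le> 1"
proof -
  let ?d = "vdegree E w" and ?c = "\<lambda>e. card (neighbours E w \<inter> e)" and ?R = "{e. e \<in> M \<and> w \<notin> e}"
  let ?t = "\<lambda>e. log_factor ?d - real (?c e) * (log_factor ?d - log_factor (?d - 1)) - log_factor (?d - ?c e)"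
  \<comment> \<open>The edge of \<open>M\<close> at \<open>w\<close> contains exactly one neighbour of \<open>w\<close>, namely its partner.\<close>
  obtain e0 where e0: "e0 \<in> M" "w \<in> e0" using M w by (auto simp: perfect_matching_def)
  then have "e0 \<in> E" using M by (auto simp: perfect_matching_def)
  then obtain x where x: "e0 = {w, x}" using e0 edge_other_end by metis
  then have "neighbours E w \<inter> e0 = {x}"
    using \<open>e0 \<in> E\<close> not_neighbour_self by (auto simp: neighbours_def)
  then have c0: "?c e0 = 1" by simp
  have finM: "finite M" by (rule matching_finite[OF M])
  have R: "?R = M - {e0}" using matching_disjoint[OF M] e0 by blast
  have "(\<Sum>e\<in>M. ?c e) = ?d"
    using sum_card_Int_matching[OF M neighbours_subset] by (simp add: vdegree_eq_card_neighbours)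
  then have d: "?d = 1 + (\<Sum>e\<in>?R. ?c e)"
    unfolding R using sum.remove[OF finM e0(1), of ?c] c0 by simp
  have cardR: "card M = card ?R + 1"
    unfolding R using card.remove[OF finM e0(1)] by simp
  have c: "?c e \<le> 2 \<and> ?c e < ?d" if "e \<in> ?R" for e
  proof
    have "e \<in> E" using that M by (auto simp: perfect_matching_def)
    then show "?c e \<le> 2" using card_edge finite_edge card_mono[of e "neighbours E w \<inter> e"] by simp
    have "?c e \<le> (\<Sum>e\<in>?R. ?c e)" using that finM by (intro member_le_sum) auto
    then show "?c e < ?d" using d by simp
  qed
  have t: "?t e \<ge> 0 \<and> (?t e = 0 \<longrightarrow> ?c e \<le> 1)" if "e \<in> ?R" for e
  proof -
    have "?c e \<le> 2" "?c e < ?d" using c[OF that] by auto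
    from log_factor_diff_le[OF this] show ?thesis by fastforce
  qed
  have "(\<Sum>e\<in>?R. log_factor (vdegree (avoiding E e) w)) = (\<Sum>e\<in>?R. log_factor (?d - ?c e))"
    by (intro sum.cong) (auto simp: vdegree_avoiding)
  moreover have "(\<Sum>e\<in>?R. ?t e) = real (card ?R) * log_factor ?d
      - real (\<Sum>e\<in>?R. ?c e) * (log_factor ?d - log_factor (?d - 1)) - (\<Sum>e\<in>?R. log_factor (?d - ?c e))"
    by (simp add: sum_subtractf sum_distrib_right)
  moreover have "2 * (real (card ?R) * log_factor ?d - real (\<Sum>e\<in>?R. ?c e) * (log_factor ?d - log_factor (?d - 1)))
      = real (card V) * log_factor ?d - ln ?d"
  proof -
    let ?k = "\<Sum>e\<in>?R. ?c e"
    have "2 * (real (card ?R) * log_factor ?d - real ?k * (log_factor ?d - log_factor (?d - 1)))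
        = real (card V) * log_factor ?d - 2 * real ?d * log_factor ?d + 2 * real ?k * log_factor ?k"
      using cardR d card_verts_matching[OF M] by (simp add: algebra_simps)
    also have "\<dots> = real (card V) * log_factor ?d - ln (fact ?d) + ln (fact ?k)"
      by (simp only: two_mult_log_factor)
    also have "ln (fact ?d :: real) = ln ?d + ln (fact ?k)"
      by (simp only: d ln_fact_Suc plus_1_eq_Suc)
    finally show ?thesis by simp
  qed
  ultimately have sum_t: "2 * (\<Sum>e\<in>?R. ?t e) = real (card V) * log_factor ?d
      - (ln ?d + 2 * (\<Sum>e\<in>?R. log_factor (vdegree (avoiding E e) w)))"
    by simp
  have "(\<Sum>e\<in>?R. ?t e) \<ge> 0" using t by (intro sum_nonneg) auto
  then show "ln ?d + 2 * (\<Sum>e\<in>?R. log_factor (vdegree (avoiding E e) w)) \<le> real (card V) * log_factor ?d"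
    using sum_t by linarith
  assume "ln ?d + 2 * (\<Sum>e\<in>?R. log_factor (vdegree (avoiding E e) w)) = real (card V) * log_factor ?d"
    and e: "e \<in> M" "w \<notin> e"
  then have "(\<Sum>e\<in>?R. ?t e) = 0" using sum_t by linarith
  moreover have "finite ?R" using finM by simp
  ultimately have "\<forall>e\<in>?R. ?t e = 0" using t sum_nonneg_eq_0_iff[of ?R ?t] by blast
  then show "?c e \<le> 1" using t e by blast
qed

text \<open>The global bookkeeping. On the right-hand side the terms \<open>ln (vdegree E v)\<close> of the first sum cancel
  against those of the third, the terms \<open>p e * ln (p e)\<close> of the first against the second, and the
  degrees after deletion of the second against the third. The second cancellation holds because
  each edge \<open>e\<close> has two ends and lies in \<open>p e\<close> perfect matchings. If \<open>P > 0\<close>, each of the summands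
  on the right is nonnegative, by \<open>vertex_slack\<close>, induction and \<open>matching_slack\<close> respectively.\<close>
lemma slack_sum:
  fixes p :: "'a set \<Rightarrow> real"
  defines "p \<equiv> \<lambda>e. real (perfmat (V - e) (avoiding E e))" and "P \<equiv> real (perfmat V E)"
  shows "real (card V) * P * ((\<Sum>v\<in>V. log_factor (vdegree E v)) - ln P)
    = (\<Sum>v\<in>V. P * ln (vdegree E v) + (\<Sum>e | e \<in> E \<and> v \<in> e. p e * ln (p e)) - P * ln P)
    + 2 * (\<Sum>M | perfect_matching V E M. \<Sum>e\<in>M. (\<Sum>w\<in>V - e. log_factor (vdegree (avoiding E e) w)) - ln (p e))
    + (\<Sum>M | perfect_matching V E M. \<Sum>w\<in>V. real (card V) * log_factor (vdegree E w)
        - (ln (vdegree E w) + 2 * (\<Sum>e | e \<in> M \<and> w \<notin> e. log_factor (vdegree (avoiding E e) w))))"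
proof -
  let ?MS = "{M. perfect_matching V E M}"
  let ?n = "real (card V)" and ?S = "\<Sum>v\<in>V. log_factor (vdegree E v)" and ?L = "\<Sum>v\<in>V. ln (real (vdegree E v))"
  let ?D = "\<Sum>M\<in>?MS. \<Sum>e\<in>M. \<Sum>w\<in>V - e. log_factor (vdegree (avoiding E e) w)"
  have card: "real (card ?MS) = P" by (simp add: P_def perfmat_def)
  have J: "(\<Sum>v\<in>V. P * ln (vdegree E v) + (\<Sum>e | e \<in> E \<and> v \<in> e. p e * ln (p e)) - P * ln P)
      = P * ?L + 2 * (\<Sum>e\<in>E. p e * ln (p e)) - ?n * P * ln P"
    by (simp add: sum_subtractf sum.distrib sum_distrib_left sum_verts_sum_incident_edges)
  have I: "(\<Sum>M\<in>?MS. \<Sum>e\<in>M. (\<Sum>w\<in>V - e. log_factor (vdegree (avoiding E e) w)) - ln (p e))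
      = ?D - (\<Sum>e\<in>E. p e * ln (p e))"
    by (simp add: sum_subtractf sum_matchings_eq_sum_edges p_def)
  have D: "?D = (\<Sum>M\<in>?MS. \<Sum>w\<in>V. \<Sum>e | e \<in> M \<and> w \<notin> e. log_factor (vdegree (avoiding E e) w))"
  proof (intro sum.cong refl)
    fix M assume "M \<in> ?MS"
    then have "finite M" using matching_finite by blast
    have "(\<Sum>e\<in>M. \<Sum>w\<in>V - e. log_factor (vdegree (avoiding E e) w))
        = (\<Sum>e\<in>M. \<Sum>w | w \<in> V \<and> w \<notin> e. log_factor (vdegree (avoiding E e) w))"
      by (intro sum.cong) auto
    also have "\<dots> = (\<Sum>w\<in>V. \<Sum>e | e \<in> M \<and> w \<notin> e. log_factor (vdegree (avoiding E e) w))"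
      by (rule sum.swap_restrict[OF \<open>finite M\<close> finite_verts])
    finally show "(\<Sum>e\<in>M. \<Sum>w\<in>V - e. log_factor (vdegree (avoiding E e) w))
        = (\<Sum>w\<in>V. \<Sum>e | e \<in> M \<and> w \<notin> e. log_factor (vdegree (avoiding E e) w))" .
  qed
  have K: "(\<Sum>M\<in>?MS. \<Sum>w\<in>V. ?n * log_factor (vdegree E w)
        - (ln (vdegree E w) + 2 * (\<Sum>e | e \<in> M \<and> w \<notin> e. log_factor (vdegree (avoiding E e) w))))
      = P * (?n * ?S) - P * ?L - 2 * ?D"
    unfolding D by (simp add: sum_subtractf sum.distrib flip: sum_distrib_left) (simp add: card algebra_simps)
  show ?thesis unfolding J I K by (simp add: algebra_simps)
qed

text \<open>The induction step, together with all consequences of equality. The bound for the smaller graphs is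
  only assumed where they have a perfect matching, and this holds for every edge of a perfect
  matching. In the equality case it holds for all edges, since the first conclusion makes
  \<open>perfmat (V - e) (avoiding E e)\<close> nonzero.\<close>
lemma perfmat_step:
  assumes pos: "perfmat V E > 0"
    and IH: "\<And>e. e \<in> E \<Longrightarrow> perfmat (V - e) (avoiding E e) > 0 \<Longrightarrow>
      ln (perfmat (V - e) (avoiding E e)) \<le> (\<Sum>w\<in>V - e. log_factor (vdegree (avoiding E e) w))"
  shows "ln (perfmat V E) \<le> (\<Sum>v\<in>V. log_factor (vdegree E v)) \<and>
    (ln (perfmat V E) = (\<Sum>v\<in>V. log_factor (vdegree E v)) \<longrightarrow>
      (\<forall>e\<in>E. (\<forall>v\<in>e. perfmat (V - e) (avoiding E e) * vdegree E v = perfmat V E) \<and>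
        ln (perfmat (V - e) (avoiding E e)) = (\<Sum>w\<in>V - e. log_factor (vdegree (avoiding E e) w)) \<and>
        (\<forall>w\<in>V - e. card (neighbours E w \<inter> e) \<le> 1)))"
proof (cases "V = {}")
  case True
  then show ?thesis using perfmat_no_verts by simp
next
  case False
  define p where "p e = real (perfmat (V - e) (avoiding E e))" for e
  define P where "P = real (perfmat V E)"
  define S where "S = (\<Sum>v\<in>V. log_factor (vdegree E v))"
  define I where "I e = (\<Sum>w\<in>V - e. log_factor (vdegree (avoiding E e) w)) - ln (p e)" for e
  define J where "J v = P * ln (vdegree E v) + (\<Sum>e | e \<in> E \<and> v \<in> e. p e * ln (p e)) - P * ln P" for v
  define K where "K M w = real (card V) * log_factor (vdegree E w)
      - (ln (vdegree E w) + 2 * (\<Sum>e | e \<in> M \<and> w \<notin> e. log_factor (vdegree (avoiding E e) w)))" for M w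
  let ?MS = "{M. perfect_matching V E M}"
  let ?I = "\<Sum>M\<in>?MS. \<Sum>e\<in>M. I e" and ?J = "\<Sum>v\<in>V. J v" and ?K = "\<Sum>M\<in>?MS. \<Sum>w\<in>V. K M w"
  have total: "real (card V) * P * (S - ln P) = ?J + 2 * ?I + ?K"
    unfolding I_def J_def K_def S_def P_def p_def by (rule slack_sum)
  have factor: "real (card V) * P > 0"
    using False finite_verts pos by (simp add: P_def card_gt_0_iff)
  have p_pos: "perfmat (V - e) (avoiding E e) > 0" if "M \<in> ?MS" "e \<in> M" for M e
  proof -
    have "e \<in> E" using that by (auto simp: perfect_matching_def)
    moreover have "M \<in> {M. perfect_matching V E M \<and> e \<in> M}" using that by simp
    ultimately show ?thesis
      using finite_matchings finite_subset[of "{M. perfect_matching V E M \<and> e \<in> M}" ?MS]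
      by (auto simp: perfmat_avoiding card_gt_0_iff)
  qed
  have J: "J v \<ge> 0" if "v \<in> V" for v
    using vertex_slack(1)[OF that pos] by (simp add: J_def P_def p_def)
  have I: "I e \<ge> 0" if "M \<in> ?MS" "e \<in> M" for M e
    using IH[OF _ p_pos[OF that]] that by (auto simp: I_def p_def perfect_matching_def)
  have K: "K M w \<ge> 0" if "M \<in> ?MS" "w \<in> V" for M w
    using matching_slack(1)[of M w] that by (simp add: K_def)
  have JIK: "?J \<ge> 0" "?I \<ge> 0" "?K \<ge> 0" using J I K by (auto intro!: sum_nonneg)
  then have "real (card V) * P * (S - ln P) \<ge> 0" unfolding total by simp
  then have le: "ln P \<le> S" using factor by (simp add: zero_le_mult_iff)
  have tight: "(\<forall>v\<in>e. perfmat (V - e) (avoiding E e) * vdegree E v = perfmat V E) \<and>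
      ln (p e) = (\<Sum>w\<in>V - e. log_factor (vdegree (avoiding E e) w)) \<and>
      (\<forall>w\<in>V - e. card (neighbours E w \<inter> e) \<le> 1)"
    if eq: "ln P = S" and e: "e \<in> E" for e
  proof -
    have "?J + 2 * ?I + ?K = 0" using total eq by simp
    then have J0: "?J = 0" and I0: "?I = 0" and K0: "?K = 0" using JIK by linarith+
    have regular: "perfmat (V - e) (avoiding E e) * vdegree E v = perfmat V E" if "v \<in> e" for v
    proof -
      have v: "v \<in> V" using that e edge_subset by blast
      then have "J v = 0" using J0 J finite_verts by (simp add: sum_nonneg_eq_0_iff)
      then show ?thesis using vertex_slack(2)[OF v pos _ e that] by (simp add: J_def P_def p_def)
    qed
    obtain v where "v \<in> e" using card_edge[OF e] by fastforce
    with regular pos have "perfmat (V - e) (avoiding E e) > 0" by (metis gr0I mult_zero_left)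
    then obtain M where M: "M \<in> ?MS" "e \<in> M"
      using perfmat_avoiding[OF e] by (auto simp: card_gt_0_iff)
    have "(\<Sum>e\<in>M. I e) = 0"
      using I0 I M(1) finite_matchings by (subst (asm) sum_nonneg_eq_0_iff) (auto intro!: sum_nonneg)
    then have "I e = 0"
      using I M matching_finite by (subst (asm) sum_nonneg_eq_0_iff) auto
    moreover have "card (neighbours E w \<inter> e) \<le> 1" if w: "w \<in> V - e" for w
    proof -
      have "(\<Sum>w\<in>V. K M w) = 0"
        using K0 K M(1) finite_matchings by (subst (asm) sum_nonneg_eq_0_iff) (auto intro!: sum_nonneg)
      then have "K M w = 0"
        using K[OF M(1)] w finite_verts by (subst (asm) sum_nonneg_eq_0_iff) auto
      then show ?thesis using matching_slack(2)[of M w e] M w by (simp add: K_def)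
    qed
    ultimately show ?thesis using regular by (simp add: I_def)
  qed
  show ?thesis using le tight unfolding P_def S_def p_def by blast
qed

end

lemma ln_perfmat_le:
  assumes "finite_simple_graph V E" "perfmat V E > 0"
  shows "ln (perfmat V E) \<le> (\<Sum>v\<in>V. log_factor (vdegree E v))"
  using assms
proof (induction "card V" arbitrary: V E rule: less_induct)
  case less
  interpret finite_simple_graph V E by (rule less.prems)
  have "card (V - e) < card V" if "e \<in> E" for e
  proof (rule psubset_card_mono[OF finite_verts])
    have "e \<noteq> {}" "e \<subseteq> V" using card_edge[OF that] edge_subset[OF that] by auto
    then show "V - e \<subset> V" by blast
  qed
  then show ?case using perfmat_step[OF less.prems(2)] less.hyps avoiding_graph by blast
qed

section \<open>Graphs attaining the bound\<close>

text \<open>Among the graphs without isolated vertices this singles out the disjoint unions of complete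
  balanced bipartite graphs, by a condition on edges instead of components. It excludes triangles: a
  common neighbour \<open>a\<close> of \<open>u\<close> and \<open>v\<close> would give the edge \<open>{a, a}\<close>.\<close>
definition balanced_biclique_at_edges :: "'a set set \<Rightarrow> bool" where
  "balanced_biclique_at_edges E \<longleftrightarrow> (\<forall>u v. {u, v} \<in> E \<longrightarrow>
     vdegree E u = vdegree E v \<and> (\<forall>a\<in>neighbours E u. \<forall>b\<in>neighbours E v. {a, b} \<in> E))"

lemma balanced_biclique_at_edgesD:
  assumes "balanced_biclique_at_edges E" "{u, v} \<in> E"
  shows "vdegree E u = vdegree E v"
    and "a \<in> neighbours E u \<Longrightarrow> b \<in> neighbours E v \<Longrightarrow> {a, b} \<in> E"
  using assms unfolding balanced_biclique_at_edges_def by blast+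

context finite_simple_graph
begin

lemma tight_edge:
  assumes pos: "perfmat V E > 0" and tight: "ln (perfmat V E) = (\<Sum>v\<in>V. log_factor (vdegree E v))"
    and e: "e \<in> E"
  shows "v \<in> e \<Longrightarrow> perfmat (V - e) (avoiding E e) * vdegree E v = perfmat V E"
    and "ln (perfmat (V - e) (avoiding E e)) = (\<Sum>w\<in>V - e. log_factor (vdegree (avoiding E e) w))"
    and "w \<in> V - e \<Longrightarrow> card (neighbours E w \<inter> e) \<le> 1"
  using perfmat_step[OF pos] ln_perfmat_le avoiding_graph tight e by blast+

lemma tight_vdegree_eq:
  assumes "perfmat V E > 0" "ln (perfmat V E) = (\<Sum>v\<in>V. log_factor (vdegree E v))" "{u, v} \<in> E"
  shows "vdegree E u = vdegree E v"
proof -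
  let ?q = "perfmat (V - {u, v}) (avoiding E {u, v})"
  have "?q * vdegree E u = perfmat V E" "?q * vdegree E v = perfmat V E"
    using tight_edge(1)[OF assms] by auto
  then show ?thesis using assms(1) by (metis mult_cancel1 gr_implies_not0 mult_zero_left)
qed

text \<open>Deleting the ends of an edge of a triangle lowers the degree of the third vertex by 2, where the
  concavity of \<open>log_factor\<close> is strict.\<close>
lemma tight_triangle_free:
  assumes "perfmat V E > 0" "ln (perfmat V E) = (\<Sum>v\<in>V. log_factor (vdegree E v))"
    and "{u, v} \<in> E" "w \<in> neighbours E u"
  shows "w \<notin> neighbours E v"
proof
  assume w: "w \<in> neighbours E v"
  have "w \<in> V - {u, v}" using w assms(4) neighbours_subset not_neighbour_self by blast
  then have "card (neighbours E w \<inter> {u, v}) \<le> 1" using tight_edge(3)[OF assms(1-3)] by blast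
  moreover have "neighbours E w \<inter> {u, v} = {u, v}"
    using w assms(4) by (auto simp: neighbours_commute[of u] neighbours_commute[of v])
  ultimately show False using edge_ends[OF assms(3)] by simp
qed

text \<open>Take a path \<open>a, u, v, b\<close> and delete \<open>a\<close> and \<open>u\<close>. What remains is again extremal, so the adjacent
  vertices \<open>v\<close> and \<open>b\<close> have equal degrees before and after the deletion and therefore lose equally
  many neighbours. As \<open>v\<close> loses \<open>u\<close>, the vertex \<open>b\<close> loses \<open>a\<close> or \<open>u\<close>; it is not adjacent to \<open>u\<close>
  because \<open>u, v, b\<close> would be a triangle.\<close>
lemma tight_imp_balanced_biclique_at_edges:
  assumes pos: "perfmat V E > 0" and tight: "ln (perfmat V E) = (\<Sum>v\<in>V. log_factor (vdegree E v))"
  shows "balanced_biclique_at_edges E"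
proof -
  have "{a, b} \<in> E" if uv: "{u, v} \<in> E" and a: "a \<in> neighbours E u" and b: "b \<in> neighbours E v" for u v a b
  proof (cases "a = v \<or> b = u")
    case True
    then show ?thesis using a b by (auto simp: neighbours_def insert_commute)
  next
    case False
    let ?e = "{a, u}"
    have e: "?e \<in> E" using a by (simp add: neighbours_def insert_commute)
    interpret del: finite_simple_graph "V - ?e" "avoiding E ?e" by (rule avoiding_graph)
    have b_u: "b \<notin> neighbours E u" using tight_triangle_free[OF pos tight uv] b by blast
    have "v \<noteq> u" "b \<noteq> v" "b \<noteq> a"
      using edge_ends[OF uv] not_neighbour_self b b_u a by auto
    then have outside: "v \<notin> ?e" "b \<notin> ?e" using False by auto
    then have "{v, b} \<in> avoiding E ?e" using b by (auto simp: avoiding_def neighbours_def)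
    moreover have "perfmat (V - ?e) (avoiding E ?e) > 0"
      using tight_edge(1)[OF pos tight e, of u] pos by (metis gr0I insertCI mult_zero_left)
    ultimately have "vdegree (avoiding E ?e) v = vdegree (avoiding E ?e) b"
      using del.tight_vdegree_eq tight_edge(2)[OF pos tight e] by blast
    moreover have "vdegree E v = vdegree E b"
      using tight_vdegree_eq[OF pos tight] b by (simp add: neighbours_def)
    moreover have "card (neighbours E v \<inter> ?e) \<le> vdegree E v" "card (neighbours E b \<inter> ?e) \<le> vdegree E b"
      using finite_neighbours by (auto simp: vdegree_eq_card_neighbours intro: card_mono)
    ultimately have "card (neighbours E v \<inter> ?e) = card (neighbours E b \<inter> ?e)"
      using outside by (simp add: vdegree_avoiding)
    moreover have "u \<in> neighbours E v \<inter> ?e" using uv by (simp add: neighbours_def insert_commute)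
    then have "card (neighbours E v \<inter> ?e) > 0" by (auto simp: card_gt_0_iff)
    ultimately have "neighbours E b \<inter> ?e \<noteq> {}" by (metis card.empty less_irrefl)
    moreover have "u \<notin> neighbours E b" using b_u neighbours_commute by metis
    ultimately have "a \<in> neighbours E b" by blast
    then show ?thesis by (simp add: neighbours_def insert_commute)
  qed
  then show ?thesis
    unfolding balanced_biclique_at_edges_def using tight_vdegree_eq[OF assms] by blast
qed

end

section \<open>Matchings in unions of balanced bicliques\<close>

lemma (in finite_simple_graph) biclique_at_edge_disjoint:
  assumes "balanced_biclique_at_edges E" "{u, v} \<in> E"
  shows "neighbours E u \<inter> neighbours E v = {}"
proof -
  have "{a, a} \<in> E" if "a \<in> neighbours E u \<inter> neighbours E v" for a
    using balanced_biclique_at_edgesD(2)[OF assms] that by blast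
  then show ?thesis using edge_ends by blast
qed

lemma (in finite_simple_graph) biclique_at_edge_vdegree:
  assumes bal: "balanced_biclique_at_edges E" and e: "{u, v} \<in> E"
    and w: "w \<in> neighbours E u \<union> neighbours E v"
  shows "vdegree E w = vdegree E u"
  using w balanced_biclique_at_edgesD(1)[OF bal] e unfolding neighbours_def by (metis UnE mem_Collect_eq)

lemma (in finite_simple_graph) biclique_at_edge_closed:
  assumes bal: "balanced_biclique_at_edges E" and e: "{u, v} \<in> E"
    and ab: "{a, b} \<in> E" and a: "a \<in> neighbours E u"
  shows "b \<in> neighbours E v"
proof -
  have "{u, a} \<in> E" "v \<in> neighbours E u" "b \<in> neighbours E a"
    using assms by (auto simp: neighbours_def)
  then have "{v, b} \<in> E" using balanced_biclique_at_edgesD(2)[OF bal] by blast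
  then show ?thesis by (simp add: neighbours_def)
qed

text \<open>Deleting two adjacent vertices turns their component, a copy of \<open>K\<^sub>d\<^sub>,\<^sub>d\<close>, into
  \<open>K\<^sub>d\<^sub>-\<^sub>1\<^sub>,\<^sub>d\<^sub>-\<^sub>1\<close> and leaves the other components alone.\<close>
lemma (in finite_simple_graph) vdegree_avoiding_biclique:
  assumes bal: "balanced_biclique_at_edges E" and e: "{u, v} \<in> E" and w: "w \<notin> {u, v}"
  shows "vdegree (avoiding E {u, v}) w = (if w \<in> neighbours E u \<union> neighbours E v
      then vdegree E u - 1 else vdegree E w)"
proof (cases "w \<in> neighbours E u \<union> neighbours E v")
  case True
  have "neighbours E u \<inter> neighbours E v = {}" by (rule biclique_at_edge_disjoint[OF bal e])
  then have "neighbours E w \<inter> {u, v} = {u} \<or> neighbours E w \<inter> {u, v} = {v}"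
    using True by (auto simp: neighbours_commute[of _ E w])
  then have "card (neighbours E w \<inter> {u, v}) = 1" by auto
  then show ?thesis
    using True vdegree_avoiding[OF w] biclique_at_edge_vdegree[OF bal e True] by simp
next
  case False
  then have "neighbours E w \<inter> {u, v} = {}" by (auto simp: neighbours_commute[of _ E w])
  then have "card (neighbours E w \<inter> {u, v}) = 0" by simp
  then show ?thesis using False vdegree_avoiding[OF w] by simp
qed

lemma (in finite_simple_graph) avoiding_balanced_biclique:
  assumes bal: "balanced_biclique_at_edges E" and no_iso: "\<forall>v\<in>V. vdegree E v \<noteq> 0"
    and e: "{u, v} \<in> E"
  shows "balanced_biclique_at_edges (avoiding E {u, v})"
    and "\<forall>w\<in>V - {u, v}. vdegree (avoiding E {u, v}) w \<noteq> 0"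
proof -
  let ?e = "{u, v}" and ?B = "neighbours E u \<union> neighbours E v"
  have vu: "{v, u} \<in> E" using e by (simp add: insert_commute)
  show "\<forall>w\<in>V - ?e. vdegree (avoiding E ?e) w \<noteq> 0"
  proof
    fix w assume w: "w \<in> V - ?e"
    show "vdegree (avoiding E ?e) w \<noteq> 0"
    proof (cases "w \<in> ?B")
      case True
      moreover have "v \<in> neighbours E u" "u \<in> neighbours E v"
        using e vu by (auto simp: neighbours_def)
      ultimately obtain x y where xy: "x \<in> ?e" "{w, y} \<subseteq> neighbours E x" "y \<in> ?e"
        by blast
      then have "card {w, y} \<le> vdegree E x"
        unfolding vdegree_eq_card_neighbours using finite_neighbours by (intro card_mono)
      moreover have "w \<noteq> y" using w xy by auto
      moreover have "vdegree E x = vdegree E u"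
        using xy(1) balanced_biclique_at_edgesD(1)[OF bal e] by auto
      ultimately have "vdegree E u \<ge> 2" by simp
      then show ?thesis using vdegree_avoiding_biclique[OF bal e, of w] w True by simp
    next
      case False
      then show ?thesis using vdegree_avoiding_biclique[OF bal e, of w] w no_iso by simp
    qed
  qed
  show "balanced_biclique_at_edges (avoiding E ?e)"
    unfolding balanced_biclique_at_edges_def
  proof (intro allI impI conjI ballI)
    fix a b assume ab': "{a, b} \<in> avoiding E ?e"
    then have ab: "{a, b} \<in> E" "{b, a} \<in> E" and out: "a \<notin> ?e" "b \<notin> ?e"
      by (auto simp: avoiding_def insert_commute)
    have "a \<in> ?B \<longleftrightarrow> b \<in> ?B"
      using biclique_at_edge_closed[OF bal e] biclique_at_edge_closed[OF bal vu] ab by blast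
    moreover have "vdegree E a = vdegree E b"
      by (rule balanced_biclique_at_edgesD(1)[OF bal ab(1)])
    ultimately show "vdegree (avoiding E ?e) a = vdegree (avoiding E ?e) b"
      using vdegree_avoiding_biclique[OF bal e] out by simp
    fix c d assume "c \<in> neighbours (avoiding E ?e) a" "d \<in> neighbours (avoiding E ?e) b"
    then have c: "c \<in> neighbours E a" "c \<notin> ?e" and d: "d \<in> neighbours E b" "d \<notin> ?e"
      using out by (auto simp: neighbours_avoiding)
    then have "{c, d} \<in> E" using balanced_biclique_at_edgesD(2)[OF bal ab(1)] by blast
    then show "{c, d} \<in> avoiding E ?e" using c d by (auto simp: avoiding_def)
  qed
qed

text \<open>Expand at a vertex \<open>u\<close> of degree \<open>d\<close>. Each of the \<open>d\<close> branches replaces the \<open>2 d\<close> factors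
  belonging to the component \<open>K\<^sub>d\<^sub>,\<^sub>d\<close>, whose product is \<open>d!\<close>, by the \<open>2 (d - 1)\<close> factors of
  \<open>K\<^sub>d\<^sub>-\<^sub>1\<^sub>,\<^sub>d\<^sub>-\<^sub>1\<close>, whose product is \<open>(d - 1)!\<close>. So a branch contributes the claimed value divided by
  \<open>d\<close>.\<close>
lemma perfmat_balanced_biclique:
  assumes "finite_simple_graph V E" "balanced_biclique_at_edges E" "\<forall>v\<in>V. vdegree E v \<noteq> 0"
  shows "real (perfmat V E) = exp (\<Sum>v\<in>V. log_factor (vdegree E v))"
  using assms
proof (induction "card V" arbitrary: V E rule: less_induct)
  case less
  interpret finite_simple_graph V E by (rule less.prems)
  note bal = less.prems(2)
  show ?case
  proof (cases "V = {}")
    case True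
    then show ?thesis using perfmat_no_verts by simp
  next
    case False
    then obtain u where u: "u \<in> V" by blast
    let ?d = "vdegree E u" and ?S = "\<Sum>v\<in>V. log_factor (vdegree E v)"
    have d: "?d \<noteq> 0" using less.prems(3) u by blast
    have branch: "real (perfmat (V - e) (avoiding E e)) = exp ?S / ?d" if e: "e \<in> E" "u \<in> e" for e
    proof -
      obtain v where v: "e = {u, v}" using edge_other_end[OF e] by blast
      let ?B = "neighbours E u \<union> neighbours E v" and ?deg = "vdegree (avoiding E e)"
      have uv: "{u, v} \<in> E" using e v by simp
      have "?B \<subseteq> V" "finite ?B" using neighbours_subset finite_neighbours by blast+
      moreover have "e \<subseteq> ?B" using uv unfolding v by (auto simp: neighbours_def insert_commute)
      ultimately have B: "?B \<subseteq> V" "e \<subseteq> ?B" "finite ?B" by blast+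
      have card_e: "card e = 2" using card_edge e by blast
      have "vdegree E v = ?d" using balanced_biclique_at_edgesD(1)[OF bal uv] by simp
      then have card_B: "card ?B = 2 * ?d"
        using finite_neighbours biclique_at_edge_disjoint[OF bal uv]
        by (simp add: card_Un_disjoint flip: vdegree_eq_card_neighbours)
      have inside: "?deg w = ?d - 1" if "w \<in> ?B - e" for w
        using vdegree_avoiding_biclique[OF bal uv, of w] that v by auto
      have outside: "?deg w = vdegree E w" if "w \<in> V - ?B" for w
        using vdegree_avoiding_biclique[OF bal uv, of w] that v B(2) by auto
      have "(\<Sum>w\<in>V - e. log_factor (?deg w)) = (\<Sum>w\<in>V - ?B. log_factor (?deg w)) + (\<Sum>w\<in>?B - e. log_factor (?deg w))"
        using B finite_verts by (subst sum.union_disjoint[symmetric]) (auto intro!: sum.cong)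
      also have "\<dots> = (\<Sum>w\<in>V - ?B. log_factor (vdegree E w)) + real (2 * ?d - 2) * log_factor (?d - 1)"
        using inside outside card_B card_e B
        by (simp add: card_Diff_subset finite_subset[OF B(2,3)])
      also have "(\<Sum>w\<in>V - ?B. log_factor (vdegree E w)) = ?S - real (2 * ?d) * log_factor ?d"
      proof -
        have "?S = (\<Sum>w\<in>V - ?B. log_factor (vdegree E w)) + (\<Sum>w\<in>?B. log_factor (vdegree E w))"
          by (rule sum.subset_diff[OF B(1) finite_verts])
        also have "(\<Sum>w\<in>?B. log_factor (vdegree E w)) = real (2 * ?d) * log_factor ?d"
          using biclique_at_edge_vdegree[OF bal uv] card_B by simp
        finally show ?thesis by simp
      qed
      also have "?S - real (2 * ?d) * log_factor ?d + real (2 * ?d - 2) * log_factor (?d - 1) = ?S - ln ?d"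
      proof -
        obtain k where k: "?d = Suc k" using d by (cases ?d) auto
        have "real (2 * ?d) * log_factor ?d = ln (fact ?d)" "real (2 * ?d - 2) * log_factor (?d - 1) = ln (fact k)"
          using two_mult_log_factor[of ?d] two_mult_log_factor[of k] k by simp_all
        then show ?thesis by (simp add: k ln_fact_Suc del: fact_Suc of_nat_Suc)
      qed
      finally have sum: "(\<Sum>w\<in>V - e. log_factor (?deg w)) = ?S - ln ?d" .
      have "card (V - e) < card V"
        using u e finite_verts by (intro psubset_card_mono) auto
      then have "real (perfmat (V - e) (avoiding E e)) = exp (?S - ln ?d)"
        using less.hyps[OF _ avoiding_graph[of e]] avoiding_balanced_biclique[OF bal less.prems(3) uv] v sum
        by simp
      then show ?thesis using d by (simp add: exp_diff)
    qed
    have "real (perfmat V E) = (\<Sum>e | e \<in> E \<and> u \<in> e. real (perfmat (V - e) (avoiding E e)))"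
      by (simp add: perfmat_expand[OF u])
    also have "\<dots> = (\<Sum>e | e \<in> E \<and> u \<in> e. exp ?S / ?d)"
      using branch by (intro sum.cong) auto
    also have "\<dots> = exp ?S" using d by (simp add: vdegree_def)
    finally show ?thesis .
  qed
qed

section \<open>Disjoint unions of complete balanced bipartite graphs\<close>

text \<open>The isomorphism with the standard model is traded for the two colour classes, pulled back along
  it in one direction and enumerated separately in the other.\<close>

lemma complete_balanced_bipartite_iff:
  "complete_balanced_bipartite V E \<longleftrightarrow>
    (\<exists>A B. finite A \<and> finite B \<and> A \<noteq> {} \<and> A \<inter> B = {} \<and> card A = card B \<and>
      V = A \<union> B \<and> E = {{a, b} | a b. a \<in> A \<and> b \<in> B})"
  (is "?L \<longleftrightarrow> (\<exists>A B. ?R A B)")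
proof
  assume ?L
  then obtain d f where graph: "finite_simple_graph V E" and d: "d \<ge> 1"
    and f: "bij_betw f V ({..<d} <+> {..<d})"
    and iso: "\<And>u v. u \<in> V \<Longrightarrow> v \<in> V \<Longrightarrow> {u, v} \<in> E \<longleftrightarrow> {f u, f v} \<in> complete_bipartite_edges d d"
    unfolding complete_balanced_bipartite_def graph_iso_def complete_bipartite_verts_def by blast
  interpret finite_simple_graph V E by (rule graph)
  define A where "A = {v \<in> V. f v \<in> Inl ` {..<d}}"
  define B where "B = {v \<in> V. f v \<in> Inr ` {..<d}}"
  have img: "f ` V = Inl ` {..<d} \<union> Inr ` {..<d}" and inj: "inj_on f V"
    using f by (auto simp: bij_betw_def Plus_def)
  have V: "V = A \<union> B" "A \<inter> B = {}" using img by (auto simp: A_def B_def)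
  have "f ` A = f ` V \<inter> Inl ` {..<d}" "f ` B = f ` V \<inter> Inr ` {..<d}" by (auto simp: A_def B_def)
  then have "f ` A = Inl ` {..<d}" "f ` B = Inr ` {..<d}" unfolding img by auto
  moreover have "card (f ` A) = card A" "card (f ` B) = card B"
    by (rule card_image, rule inj_on_subset[OF inj], simp add: V(1))+
  ultimately have card: "card A = d" "card B = d" by (simp_all add: card_image)
  have pair: "{u, v} \<in> E \<longleftrightarrow> u \<in> A \<and> v \<in> B \<or> u \<in> B \<and> v \<in> A" if "u \<in> V" "v \<in> V" for u v
    using iso[OF that] that
    by (auto simp: A_def B_def complete_bipartite_edges_def doubleton_eq_iff)
  have "E = {{a, b} | a b. a \<in> A \<and> b \<in> B}"
  proof (intro equalityI subsetI)
    fix e assume e: "e \<in> E"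
    then obtain u v where "e = {u, v}" "u \<in> V" "v \<in> V"
      using card_edge[OF e] edge_subset[OF e] by (auto simp: card_2_iff)
    then show "e \<in> {{a, b} | a b. a \<in> A \<and> b \<in> B}"
      using pair e by (auto simp: insert_commute)
  qed (use pair V in auto)
  moreover have "finite A" "finite B" "A \<noteq> {}" using card d finite_verts V(1) by auto
  ultimately have "?R A B" using V card by auto
  then show "\<exists>A B. ?R A B" by blast
next
  assume "\<exists>A B. ?R A B"
  then obtain A B where fin: "finite A" "finite B" and ne: "A \<noteq> {}" and disj: "A \<inter> B = {}"
    and card: "card A = card B" and V: "V = A \<union> B" and E: "E = {{a, b} | a b. a \<in> A \<and> b \<in> B}"
    by blast
  let ?d = "card A"
  obtain g where g: "bij_betw g A {..<?d}"
    using ex_bij_betw_finite_nat[OF fin(1)] by (auto simp: atLeast0LessThan)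
  obtain h where h: "bij_betw h B {..<?d}"
    using ex_bij_betw_finite_nat[OF fin(2)] card by (auto simp: atLeast0LessThan)
  define f :: "'a \<Rightarrow> nat + nat" where "f v = (if v \<in> A then Inl (g v) else Inr (h v))" for v
  have fB: "f b = Inr (h b)" if "b \<in> B" for b using that disj by (auto simp: f_def)
  have "bij_betw f (A \<union> B) (Inl ` {..<?d} \<union> Inr ` {..<?d})"
  proof (rule bij_betw_combine)
    show "bij_betw f A (Inl ` {..<?d})"
      using g by (auto simp: bij_betw_def f_def inj_on_def)
    show "bij_betw f B (Inr ` {..<?d})"
      using h fB by (auto simp: bij_betw_def inj_on_def image_image cong: image_cong)
  qed auto
  then have bij: "bij_betw f V (complete_bipartite_verts ?d ?d)"
    by (simp add: V complete_bipartite_verts_def Plus_def)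
  have "{u, v} \<in> E \<longleftrightarrow> {f u, f v} \<in> complete_bipartite_edges ?d ?d" if "u \<in> V" "v \<in> V" for u v
  proof -
    have "{u, v} \<in> E \<longleftrightarrow> u \<in> A \<and> v \<in> B \<or> u \<in> B \<and> v \<in> A"
      unfolding E by (auto simp: doubleton_eq_iff)
    moreover have "{f u, f v} \<in> complete_bipartite_edges ?d ?d \<longleftrightarrow> u \<in> A \<and> v \<in> B \<or> u \<in> B \<and> v \<in> A"
      using that disj V g h
      by (auto simp: f_def complete_bipartite_edges_def doubleton_eq_iff bij_betw_def)
    ultimately show ?thesis by blast
  qed
  then have "graph_iso V E (complete_bipartite_verts ?d ?d) (complete_bipartite_edges ?d ?d)"
    unfolding graph_iso_def using bij by blast
  moreover have "finite_simple_graph V E"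
  proof
    show "finite V" using fin V by simp
    have "card {a, b} = 2" if "a \<in> A" "b \<in> B" for a b
    proof -
      have "a \<noteq> b" using that disj by blast
      then show ?thesis by simp
    qed
    then show "E \<subseteq> [V]\<^bsup>2\<^esup>" unfolding E nsets_def V by auto
  qed
  moreover have "?d \<ge> 1" using fin ne by (simp add: Suc_le_eq card_gt_0_iff)
  ultimately show ?L unfolding complete_balanced_bipartite_def by blast
qed

lemma (in finite_simple_graph) disjoint_union_imp_balanced_biclique:
  assumes "disjoint_union_of_complete_balanced_bipartite V E"
  shows "balanced_biclique_at_edges E"
proof -
  obtain C :: "('a set \<times> 'a set set) set"
    where C: "\<And>H. H \<in> C \<Longrightarrow> complete_balanced_bipartite (fst H) (snd H)"
    and disj: "\<And>H K. H \<in> C \<Longrightarrow> K \<in> C \<Longrightarrow> H \<noteq> K \<Longrightarrow> disjnt (fst H) (fst K)"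
    and E: "E = (\<Union>H\<in>C. snd H)"
    using assms unfolding disjoint_union_of_complete_balanced_bipartite_def pairwise_def by blast
  have piece: "\<exists>A B. card A = card B \<and> u \<in> A \<and> v \<in> B \<and>
      (\<forall>a\<in>A. neighbours E a = B) \<and> (\<forall>b\<in>B. neighbours E b = A)" if uv: "{u, v} \<in> E" for u v
  proof -
    obtain H where H: "H \<in> C" "{u, v} \<in> snd H" using uv E by blast
    obtain A B where AB: "A \<inter> B = {}" "card A = card B" "fst H = A \<union> B"
      "snd H = {{a, b} | a b. a \<in> A \<and> b \<in> B}"
      using C[OF H(1)] unfolding complete_balanced_bipartite_iff
      by (elim exE conjE) (rule that)
    have nbh: "neighbours E w = neighbours (snd H) w" if "w \<in> fst H" for w
    proof -
      have "K = H" if K: "K \<in> C" "{w, x} \<in> snd K" for K x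
      proof (rule ccontr)
        assume "K \<noteq> H"
        interpret K: finite_simple_graph "fst K" "snd K"
          using C[OF K(1)] by (simp add: complete_balanced_bipartite_def)
        have "w \<in> fst K" using K.edge_ends[OF K(2)] by blast
        then show False using disj[OF K(1) H(1) \<open>K \<noteq> H\<close>] \<open>w \<in> fst H\<close> by (auto simp: disjnt_iff)
      qed
      then show ?thesis using H(1) unfolding neighbours_def E by blast
    qed
    have "neighbours (snd H) a = B" if "a \<in> A" for a
      using that AB(1) unfolding AB(4) neighbours_def by (auto simp: doubleton_eq_iff)
    then have NA: "\<forall>a\<in>A. neighbours E a = B" using nbh AB(3) by simp
    have "neighbours (snd H) b = A" if "b \<in> B" for b
      using that AB(1) unfolding AB(4) neighbours_def by (auto simp: doubleton_eq_iff)
    then have NB: "\<forall>b\<in>B. neighbours E b = A" using nbh AB(3) by simp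
    have "u \<in> A \<and> v \<in> B \<or> u \<in> B \<and> v \<in> A"
      using H(2) unfolding AB(4) by (auto simp: doubleton_eq_iff)
    then show ?thesis
    proof
      assume "u \<in> A \<and> v \<in> B"
      then show ?thesis using AB(2) NA NB by (intro exI[of _ A] exI[of _ B]) simp
    next
      assume "u \<in> B \<and> v \<in> A"
      then show ?thesis using AB(2) NA NB by (intro exI[of _ B] exI[of _ A]) simp
    qed
  qed
  show ?thesis unfolding balanced_biclique_at_edges_def
  proof (intro allI impI)
    fix u v assume "{u, v} \<in> E"
    then obtain A B where "card A = card B" "u \<in> A" "v \<in> B"
      and N: "\<forall>a\<in>A. neighbours E a = B" "\<forall>b\<in>B. neighbours E b = A"
      using piece[OF \<open>{u, v} \<in> E\<close>] by (elim exE conjE) (rule that)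
    then have nbh: "neighbours E u = B" "neighbours E v = A" by auto
    have "{a, b} \<in> E" if "a \<in> B" "b \<in> A" for a b
    proof -
      have "a \<in> neighbours E b" using N(1) that by simp
      then show ?thesis by (simp add: neighbours_def insert_commute)
    qed
    then show "vdegree E u = vdegree E v \<and> (\<forall>a\<in>neighbours E u. \<forall>b\<in>neighbours E v. {a, b} \<in> E)"
      using \<open>card A = card B\<close> by (simp add: vdegree_eq_card_neighbours nbh)
  qed
qed

text \<open>The component of an edge \<open>{u, v}\<close> consists of the neighbourhoods of \<open>u\<close> and \<open>v\<close>. Every neighbour of
  \<open>u\<close> has the same neighbourhood as \<open>v\<close> and conversely, hence each edge of a component determines the
  same component, and different components are disjoint.\<close>
lemma (in finite_simple_graph) balanced_biclique_imp_disjoint_union: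
  assumes bal: "balanced_biclique_at_edges E" and no_iso: "\<forall>v\<in>V. vdegree E v \<noteq> 0"
  shows "disjoint_union_of_complete_balanced_bipartite V E"
proof -
  let ?N = "neighbours E"
  define comp where "comp u v = (?N u \<union> ?N v, {{a, b} | a b. a \<in> ?N u \<and> b \<in> ?N v})" for u v
  define C where "C = {comp u v | u v. {u, v} \<in> E}"
  have comp_commute: "comp u v = comp v u" for u v
  proof -
    have "{{a, b} | a b. a \<in> ?N u \<and> b \<in> ?N v} \<subseteq> {{a, b} | a b. a \<in> ?N v \<and> b \<in> ?N u}" for u v
    proof clarify
      fix a b assume "a \<in> ?N u" "b \<in> ?N v"
      then show "\<exists>a' b'. {a, b} = {a', b'} \<and> a' \<in> ?N v \<and> b' \<in> ?N u"
        by (intro exI[of _ b] exI[of _ a]) (simp add: insert_commute)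
    qed
    then have "{{a, b} | a b. a \<in> ?N u \<and> b \<in> ?N v} = {{a, b} | a b. a \<in> ?N v \<and> b \<in> ?N u}"
      by (intro subset_antisym)
    then show ?thesis unfolding comp_def by (simp only: Un_commute)
  qed
  have N: "?N a = ?N v" if uv: "{u, v} \<in> E" and a: "a \<in> ?N u" for u v a
  proof
    show "?N a \<subseteq> ?N v"
      using biclique_at_edge_closed[OF bal uv _ a] by (auto simp: neighbours_def)
    show "?N v \<subseteq> ?N a"
      using balanced_biclique_at_edgesD(2)[OF bal uv a] by (auto simp: neighbours_def)
  qed
  have comp_eq: "comp u v = comp x y" if uv: "{u, v} \<in> E" and xy: "{x, y} \<in> E" and x: "x \<in> ?N u" for u v x y
  proof -
    have "?N x = ?N v" by (rule N[OF uv x])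
    moreover have "y \<in> ?N v" using \<open>?N x = ?N v\<close> xy by (auto simp: neighbours_def)
    then have "?N y = ?N u" using N[of v u y] uv by (simp add: insert_commute)
    ultimately have "comp x y = comp v u" unfolding comp_def by simp
    then show ?thesis using comp_commute[of u v] by simp
  qed
  have comp_unique: "H = comp x y" if "H \<in> C" "x \<in> fst H" "{x, y} \<in> E" for H x y
  proof -
    obtain u v where "{u, v} \<in> E" "H = comp u v" using \<open>H \<in> C\<close> C_def by blast
    then have "x \<in> ?N u \<or> x \<in> ?N v" using \<open>x \<in> fst H\<close> by (simp add: comp_def)
    moreover have "{v, u} \<in> E" using \<open>{u, v} \<in> E\<close> by (simp add: insert_commute)
    moreover have "H = comp v u" using \<open>H = comp u v\<close> comp_commute[of u v] by simp
    ultimately show ?thesis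
      using comp_eq \<open>{u, v} \<in> E\<close> \<open>H = comp u v\<close> \<open>{x, y} \<in> E\<close> by metis
  qed
  have has_nbh: "\<exists>y. {x, y} \<in> E" if "x \<in> V" for x
    using no_iso that by (auto simp: vdegree_eq_card_neighbours neighbours_def card_eq_0_iff)
  have verts: "fst H \<subseteq> V" if "H \<in> C" for H
    using that neighbours_subset unfolding C_def comp_def by fastforce
  have "complete_balanced_bipartite (fst H) (snd H)" if "H \<in> C" for H
  proof -
    obtain u v where uv: "{u, v} \<in> E" and H: "H = comp u v" using \<open>H \<in> C\<close> C_def by blast
    have "v \<in> ?N u" using uv by (simp add: neighbours_def)
    moreover have "card (?N u) = card (?N v)"
      using balanced_biclique_at_edgesD(1)[OF bal uv] by (simp flip: vdegree_eq_card_neighbours)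
    ultimately show ?thesis
      unfolding complete_balanced_bipartite_iff H comp_def
      using finite_neighbours biclique_at_edge_disjoint[OF bal uv]
      by (intro exI[of _ "?N u"] exI[of _ "?N v"]) auto
  qed
  moreover have "pairwise (\<lambda>H K. disjnt (fst H) (fst K)) C"
    unfolding pairwise_def disjnt_iff using comp_unique has_nbh verts by (metis subsetD)
  moreover have "V = (\<Union>H\<in>C. fst H)"
  proof (intro equalityI subsetI)
    fix x assume "x \<in> V"
    then obtain y where "{x, y} \<in> E" using has_nbh by blast
    then have "comp x y \<in> C" "x \<in> ?N y" by (auto simp: C_def neighbours_def insert_commute)
    then have "comp x y \<in> C" "x \<in> fst (comp x y)" by (auto simp: comp_def)
    then show "x \<in> (\<Union>H\<in>C. fst H)" by blast
  qed (use verts in blast)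
  moreover have "E = (\<Union>H\<in>C. snd H)"
  proof (intro equalityI subsetI)
    fix e assume e: "e \<in> E"
    then obtain u v where uv: "e = {u, v}" using card_edge[OF e] by (auto simp: card_2_iff)
    then have "comp u v \<in> C" "v \<in> ?N u" "u \<in> ?N v"
      using e by (auto simp: C_def neighbours_def insert_commute)
    moreover from this have "{v, u} \<in> snd (comp u v)" by (auto simp: comp_def)
    ultimately have "comp u v \<in> C" "e \<in> snd (comp u v)" by (simp_all add: uv insert_commute)
    then show "e \<in> (\<Union>H\<in>C. snd H)" by blast
  next
    fix e assume "e \<in> (\<Union>H\<in>C. snd H)"
    then show "e \<in> E"
      using balanced_biclique_at_edgesD(2)[OF bal] by (auto simp: C_def comp_def)
  qed
  ultimately show ?thesis unfolding disjoint_union_of_complete_balanced_bipartite_def by blast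
qed

section \<open>The bound and its equality case\<close>

lemma degree_factor_eq_exp_log_factor:
  "vdegree E v \<noteq> 0 \<Longrightarrow> degree_factor E v = exp (log_factor (vdegree E v))"
  by (simp add: degree_factor_def log_factor_def powr_def)

theorem theorem1p1:
  fixes V :: "'a set" and E :: "'a set set"
  assumes "finite_simple_graph V E"
    and "even (card V)"
  shows "real (perfmat V E) \<le> (\<Prod>v\<in>V. degree_factor E v) \<and>
    ((\<forall>v\<in>V. \<not> isolated E v) \<longrightarrow>
       (real (perfmat V E) = (\<Prod>v\<in>V. degree_factor E v) \<longleftrightarrow>
        disjoint_union_of_complete_balanced_bipartite V E))"
proof (cases "\<exists>v\<in>V. isolated E v")
  case True
  interpret finite_simple_graph V E by (rule assms)
  obtain v where v: "v \<in> V" "vdegree E v = 0" using True by (auto simp: isolated_def)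
  then have "degree_factor E v = 0" by (simp add: degree_factor_def)
  then have "(\<Prod>v\<in>V. degree_factor E v) = 0"
    using v finite_verts by (intro prod_zero) auto
  then show ?thesis using perfmat_isolated[OF v] True by auto
next
  case False
  interpret finite_simple_graph V E by (rule assms)
  let ?S = "\<Sum>v\<in>V. log_factor (vdegree E v)"
  have no_iso: "\<forall>v\<in>V. vdegree E v \<noteq> 0" using False by (simp add: isolated_def)
  then have bound: "(\<Prod>v\<in>V. degree_factor E v) = exp ?S"
    using finite_verts by (simp add: exp_sum degree_factor_eq_exp_log_factor)
  have "real (perfmat V E) \<le> exp ?S"
  proof (cases "perfmat V E = 0")
    case False
    then have "ln (perfmat V E) \<le> ?S" using ln_perfmat_le[OF assms(1)] by simp
    then have "exp (ln (real (perfmat V E))) \<le> exp ?S" by (simp only: exp_le_cancel_iff)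
    then show ?thesis using False by simp
  qed simp
  moreover have "disjoint_union_of_complete_balanced_bipartite V E" if eq: "real (perfmat V E) = exp ?S"
  proof -
    have "perfmat V E > 0" using eq exp_gt_zero[of ?S] by linarith
    moreover have "ln (perfmat V E) = ?S" by (simp add: eq)
    ultimately show ?thesis
      using tight_imp_balanced_biclique_at_edges balanced_biclique_imp_disjoint_union no_iso by blast
  qed
  moreover have "real (perfmat V E) = exp ?S" if "disjoint_union_of_complete_balanced_bipartite V E"
    using perfmat_balanced_biclique[OF assms(1) _ no_iso] disjoint_union_imp_balanced_biclique[OF that] by blast
  ultimately show ?thesis unfolding bound by blast
qed

end
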